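(* Let $0\le a<b$, $0\le c<d$ with $(0,0)\in[a,b]\times[c,d]$, let $0<\mu<1$, and let $f\in H^{\mu}([a,b]\times[c,d])$ with $f(0,0)=0$ be such that the mixed Riemann-Liouville fractional integral $\mathcal{I}^{\gamma}f$ exists, where $\gamma=(\gamma_1,\gamma_2)$ and $0<\gamma_1,\gamma_2<1$. Then $$\dim_H \mathrm{Gr}(\mathcal{I}^{\gamma}f)\le \overline{\dim}_B\, \mathrm{Gr}(\mathcal{I}^{\gamma}f)\le 3-\mu,$$ where the graph is taken over $[a,b]\times[c,d]$.
   Context: For $0<\mu<1$, $H^{\mu}([a,b]\times[c,d])$ is the set of functions $f:[a,b]\times[c,d]\to\mathbb{R}$ for which there is a constant $C>0$ with $|f(x+k_1,y+k_2)-f(x,y)|\le C\|(k_1,k_2)\|_2^{\mu}$ for all $(x,y),(x+k_1,y+k_2)\in[a,b]\times[c,d]$. The mixed Riemann-Liouville fractional integral of $f$ on $[a,b]\times[c,d]$ is $$\mathcal{I}^{\gamma}f(x,y)=\frac{1}{\Gamma(\gamma_1)\Gamma(\gamma_2)}\int_a^x\int_c^y (x-u)^{\gamma_1-1}(y-v)^{\gamma_2-1}f(u,v)\,du\,dv .$$ $\mathrm{Gr}(g)=\{(x,y,g(x,y)):(x,y)\in[a,b]\times[c,d]\}\subset\mathbb{R}^3$ is the graph of $g$. $\dim_H$ is the Hausdorff dimension. For a nonempty bounded set $E\subset\mathbb{R}^n$, $N_\delta(E)$ is the smallest number of sets of diameter at most $\delta$ that cover $E$, and $\overline{\dim}_B(E)=\limsup_{\delta\to0}\frac{\log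 N_\delta(E)}{-\log\delta}$ is the upper box dimension. *)

theory Defs
  imports "HOL-Analysis.Analysis"
begin

definition holder_class :: "real \<Rightarrow> (real \<times> real) set \<Rightarrow> (real \<times> real \<Rightarrow> real) set" where
  "holder_class \<mu> R = {f. \<exists>C>0. \<forall>x y k1 k2. (x, y) \<in> R \<longrightarrow> (x + k1, y + k2) \<in> R \<longrightarrow>
     \<bar>f (x + k1, y + k2) - f (x, y)\<bar> \<le> C * norm (k1, k2) powr \<mu>}"

(* The integrand at upper limit (x, y).  On the lines u = x and v = y, where the kernel is singular
   for orders below 1, it takes the value 0 because 0 powr r = 0; these lines are Lebesgue null. *)
definition rl_integrand ::
  "real \<Rightarrow> real \<Rightarrow> (real \<times> real \<Rightarrow> real) \<Rightarrow> real \<times> real \<Rightarrow> real \<times> real \<Rightarrow> real" where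
  "rl_integrand \<gamma>1 \<gamma>2 f = (\<lambda>(x, y) (u, v). (x - u) powr (\<gamma>1 - 1) * (y - v) powr (\<gamma>2 - 1) * f (u, v))"

definition mixed_rl_exists ::
  "real \<Rightarrow> real \<Rightarrow> real \<Rightarrow> real \<Rightarrow> (real \<times> real) set \<Rightarrow> (real \<times> real \<Rightarrow> real) \<Rightarrow> bool" where
  "mixed_rl_exists a c \<gamma>1 \<gamma>2 R f \<longleftrightarrow>
     (\<forall>(x, y)\<in>R. set_integrable lborel ({a..x} \<times> {c..y}) (rl_integrand \<gamma>1 \<gamma>2 f (x, y)))"

definition mixed_rl_integral ::
  "real \<Rightarrow> real \<Rightarrow> real \<Rightarrow> real \<Rightarrow> (real \<times> real \<Rightarrow> real) \<Rightarrow> real \<times> real \<Rightarrow> real" where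
  "mixed_rl_integral a c \<gamma>1 \<gamma>2 f = (\<lambda>(x, y). 1 / (Gamma \<gamma>1 * Gamma \<gamma>2) *
     set_lebesgue_integral lborel ({a..x} \<times> {c..y}) (rl_integrand \<gamma>1 \<gamma>2 f (x, y)))"

(* The norm of the nested product type is the Euclidean norm of three-dimensional space. *)
definition graph_over :: "(real \<times> real) set \<Rightarrow> (real \<times> real \<Rightarrow> real) \<Rightarrow> (real \<times> real \<times> real) set" where
  "graph_over R g = {(x, y, g (x, y)) | x y. (x, y) \<in> R}"

(* diam(U)^s with diam({})^s = 0 and diam(U)^0 = 1 for nonempty U.  The case s = 0 is separate
   because 0 powr 0 = 0. *)
definition diam_power :: "real \<Rightarrow> 'a::metric_space set \<Rightarrow> ennreal" where
  "diam_power s U = (if U = {} then 0 else if s = 0 then 1 else ennreal (diameter U powr s))"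

(* Boundedness is required explicitly because diameter is meaningless on unbounded sets.
   Finite covers are included, since members of the cover may be empty. *)
definition hausdorff_delta :: "real \<Rightarrow> real \<Rightarrow> 'a::metric_space set \<Rightarrow> ennreal" where
  "hausdorff_delta s \<delta> E = Inf {\<Sum>i. diam_power s (U i) | U :: nat \<Rightarrow> 'a set.
     E \<subseteq> (\<Union>i. U i) \<and> (\<forall>i. bounded (U i) \<and> diameter (U i) \<le> \<delta>)}"

definition hausdorff_measure :: "real \<Rightarrow> 'a::metric_space set \<Rightarrow> ennreal" where
  "hausdorff_measure s E = (SUP \<delta>\<in>{0<..}. hausdorff_delta s \<delta> E)"

definition hausdorff_dim :: "'a::metric_space set \<Rightarrow> ereal" where
  "hausdorff_dim E = Inf {ereal s | s. 0 \<le> s \<and> hausdorff_measure s E = 0}"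

(* Meaningful for totally bounded E and \<delta> > 0, where a finite cover exists. *)
definition covering_number :: "real \<Rightarrow> 'a::metric_space set \<Rightarrow> nat" where
  "covering_number \<delta> E = Inf {card \<U> | \<U>. finite \<U> \<and> E \<subseteq> \<Union>\<U> \<and>
     (\<forall>U\<in>\<U>. bounded U \<and> diameter U \<le> \<delta>)}"

definition upper_box_dim :: "'a::metric_space set \<Rightarrow> ereal" where
  "upper_box_dim E =
     Limsup (at_right 0) (\<lambda>\<delta>. ereal (ln (real (covering_number \<delta> E)) / (- ln \<delta>)))"

end

theory Submission
  imports Defs
begin

text \<open>
  Since \<open>(0, 0)\<close> lies in the rectangle and \<open>a, c \<ge> 0\<close>, both \<open>a\<close> and \<open>c\<close> vanish. Write \<open>g\<close> for the
  fractional integral, and let \<open>p = (x, y) \<le> p' = (x', y')\<close> componentwise. After the reflection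
  \<open>s = p - u\<close> the integral is a convolution with the kernel \<open>s1 powr (\<gamma>1 - 1) * s2 powr (\<gamma>2 - 1)\<close> over
  the box from 0 to \<open>p\<close>. In \<open>g p' - g p\<close> the kernel meets the increment of \<open>f\<close> on the small box, which
  the Hoelder condition controls, and it meets the bounded function \<open>f\<close> on the L-shaped rest of the
  large box. Hence, with \<open>\<Phi>(x, y)\<close> a multiple of \<open>x powr \<gamma>1 * y powr \<gamma>2\<close>,
  \<open>\<bar>g p' - g p\<bar> \<le> A * norm (p' - p) powr \<mu> + (\<Phi> p' - \<Phi> p)\<close> (lemma \<open>rl_increment\<close>).

  The second term cannot be absorbed into the first: if \<open>f\<close> does not vanish on the axes, then near
  them \<open>g\<close> may be only Hoelder of exponent \<open>\<gamma>1\<close> or \<open>\<gamma>2\<close>, which may be smaller than \<open>\<mu>\<close>. But \<open>\<Phi>\<close> is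
  monotone in each variable, so on an \<open>n \<times> n\<close> grid the sum of its oscillations over the cells telescopes
  to \<open>O(n)\<close>. With boxes of height \<open>1 / n\<close> it costs \<open>O(n\<^sup>2)\<close> boxes, whereas the Hoelder term costs
  \<open>O(n powr (3 - \<mu>))\<close>, which dominates as \<open>\<mu> < 1\<close>. So the exceptional behaviour near the axes does not
  affect the box dimension (lemmas \<open>graph_grid_cover\<close> and \<open>graph_dims_of_holder_up_to_monotone\<close>).

  The first inequality is the general comparison \<open>hausdorff_dim_le_upper_box_dim\<close> for totally bounded
  sets: a cover by \<open>N\<close> sets of diameter at most \<open>\<delta>\<close> has \<open>s\<close>-dimensional cost at most \<open>N * \<delta> powr s\<close>.
\<close>

section \<open>Hausdorff and upper box dimension\<close>

lemma covering_number_le_card: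
  assumes "finite \<U>" "E \<subseteq> \<Union>\<U>" "\<And>U. U \<in> \<U> \<Longrightarrow> bounded U \<and> diameter U \<le> \<delta>"
  shows "covering_number \<delta> E \<le> card \<U>"
  unfolding covering_number_def
  by (rule cInf_lower) (use assms in auto)

text \<open>
  The infimum in \<open>covering_number\<close> is a minimum only when some finite cover exists; the assumed cover
  \<open>\<U>\<close> serves that purpose.
\<close>

lemma covering_number_attained:
  assumes "finite \<U>" "E \<subseteq> \<Union>\<U>" "\<And>U. U \<in> \<U> \<Longrightarrow> bounded U \<and> diameter U \<le> \<delta>"
  obtains \<V> where "finite \<V>" "E \<subseteq> \<Union>\<V>" "\<And>U. U \<in> \<V> \<Longrightarrow> bounded U \<and> diameter U \<le> \<delta>"
    "card \<V> = covering_number \<delta> E"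
proof -
  have "covering_number \<delta> E \<in> {card \<U> | \<U>. finite \<U> \<and> E \<subseteq> \<Union>\<U> \<and>
     (\<forall>U\<in>\<U>. bounded U \<and> diameter U \<le> \<delta>)}"
    unfolding covering_number_def by (rule Inf_nat_def1) (use assms in blast)
  then show ?thesis using that by auto
qed

lemma hausdorff_delta_antimono:
  assumes "\<delta>' \<le> \<delta>" shows "hausdorff_delta s \<delta> E \<le> hausdorff_delta s \<delta>' E"
  unfolding hausdorff_delta_def
  by (rule Inf_superset_mono) (use assms order_trans in blast)

text \<open>
  Enumerating a finite cover and padding it with empty sets, which cost nothing, gives an admissible
  sequence. As \<open>s\<close> is positive, each member costs at most \<open>\<delta> powr s\<close>, also when its diameter is 0.
\<close>

lemma hausdorff_delta_le_card:
  fixes E :: "'a::metric_space set"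
  assumes fin: "finite \<U>" and cov: "E \<subseteq> \<Union>\<U>"
    and U: "\<And>U. U \<in> \<U> \<Longrightarrow> bounded U \<and> diameter U \<le> \<delta>" and s: "0 < s" and d: "0 < \<delta>"
  shows "hausdorff_delta s \<delta> E \<le> ennreal (real (card \<U>) * \<delta> powr s)"
proof -
  obtain h where h: "bij_betw h {0..<card \<U>} \<U>"
    using ex_bij_betw_nat_finite[OF fin] by auto
  define V where "V i = (if i < card \<U> then h i else {})" for i
  have V: "V i \<in> insert {} \<U>" for i
    using h by (auto simp: V_def bij_betw_def)
  have cov': "E \<subseteq> (\<Union>i. V i)"
  proof
    fix x assume "x \<in> E"
    then obtain U where "U \<in> \<U>" "x \<in> U" using cov by auto
    then have "U \<in> h ` {0..<card \<U>}" using h by (simp add: bij_betw_def)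
    then obtain i where "i < card \<U>" "h i = U" by auto
    then show "x \<in> (\<Union>i. V i)" using \<open>x \<in> U\<close> by (auto simp: V_def)
  qed
  have B: "bounded (V i) \<and> diameter (V i) \<le> \<delta>" for i
    using V[of i] U d by (auto simp: diameter_empty)
  have "hausdorff_delta s \<delta> E \<le> (\<Sum>i. diam_power s (V i))"
    unfolding hausdorff_delta_def by (rule Inf_lower) (use cov' B in blast)
  also have "\<dots> = (\<Sum>i<card \<U>. diam_power s (V i))"
    by (rule suminf_finite) (auto simp: V_def diam_power_def)
  also have "\<dots> \<le> (\<Sum>i<card \<U>. ennreal (\<delta> powr s))"
    by (rule sum_mono)
       (use B s in \<open>auto simp: diam_power_def intro!: ennreal_leI powr_mono2 diameter_ge_0\<close>)
  also have "\<dots> = ennreal (real (card \<U>) * \<delta> powr s)"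
    by (simp add: ennreal_mult ennreal_of_nat_eq_real_of_nat)
  finally show ?thesis .
qed

text \<open>
  The convention \<open>ln 0 = 0\<close> makes the quotient nonnegative even for a vanishing covering number.
\<close>

lemma upper_box_dim_nonneg: "0 \<le> upper_box_dim E"
proof -
  have "eventually (\<lambda>\<delta>. \<delta> \<in> {0<..<1::real}) (at_right 0)"
    by (rule eventually_at_right_real) simp
  then have "eventually (\<lambda>\<delta>. 0 \<le> ereal (ln (real (covering_number \<delta> E)) / (- ln \<delta>))) (at_right 0)"
  proof eventually_elim
    case (elim \<delta>)
    have "0 \<le> ln (real n)" for n :: nat by (cases n) auto
    then have "0 \<le> ln (real (covering_number \<delta> E)) / (- ln \<delta>)"
      by (rule divide_nonneg_nonneg) (use elim in simp)
    then show ?case by (simp only: zero_ereal_def ereal_less_eq)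
  qed
  then have "Limsup (at_right (0::real)) (\<lambda>_. 0::ereal) \<le> upper_box_dim E"
    unfolding upper_box_dim_def by (rule Limsup_mono)
  then show ?thesis by (simp add: Limsup_const)
qed

text \<open>
  If \<open>upper_box_dim E < t < s\<close>, then for small \<open>\<delta>\<close> there is a cover by fewer than \<open>\<delta> powr (- t)\<close> sets of
  diameter at most \<open>\<delta>\<close>, whose \<open>s\<close>-dimensional cost is at most \<open>\<delta> powr (s - t)\<close>. This tends to 0 with \<open>\<delta>\<close>,
  so the Hausdorff measure in dimension \<open>s\<close> vanishes. Total boundedness is what ties the covering
  number to an actual cover.
\<close>

lemma hausdorff_dim_le_upper_box_dim:
  fixes E :: "'a::metric_space set"
  assumes tb: "\<And>\<delta>::real. 0 < \<delta> \<Longrightarrow> \<exists>\<U>. finite \<U> \<and> E \<subseteq> \<Union>\<U> \<and> (\<forall>U\<in>\<U>. bounded U \<and> diameter U \<le> \<delta>)"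
  shows "hausdorff_dim E \<le> upper_box_dim E"
proof (rule ereal_le_real)
  fix s :: real assume "upper_box_dim E \<le> ereal s"
  show "hausdorff_dim E \<le> ereal s"
  proof (rule ereal_le_epsilon2)
    fix e :: real assume e: "0 < e"
    have s0: "0 \<le> s" using \<open>upper_box_dim E \<le> ereal s\<close> upper_box_dim_nonneg[of E]
      by (metis ereal_less_eq(5) order_trans)
    \<comment> \<open>The Hausdorff measure will vanish in dimension \<open>s + e\<close>; \<open>t\<close> lies strictly between, so that
      both the box counting bound and the decay of the cost have room \<open>e / 2\<close>.\<close>
    define t where "t = s + e / 2"
    have "upper_box_dim E < ereal t"
      using \<open>upper_box_dim E \<le> ereal s\<close> e by (auto simp: t_def intro: le_less_trans)
    then have ev: "eventually (\<lambda>\<delta>. ereal (ln (real (covering_number \<delta> E)) / (- ln \<delta>)) < ereal t) (at_right 0)"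
      unfolding upper_box_dim_def by (rule Limsup_lessD)
    have ev1: "eventually (\<lambda>\<delta>. \<delta> \<in> {0<..<1::real}) (at_right 0)"
      by (rule eventually_at_right_real) simp
    have small: "eventually (\<lambda>\<delta>. hausdorff_delta (s + e) \<delta> E \<le> ennreal (\<delta> powr (e / 2))) (at_right 0)"
      using ev ev1
    proof eventually_elim
      case (elim \<delta>)
      define N where "N = covering_number \<delta> E"
      have "0 < \<delta>" using elim by simp
      obtain \<U> where \<U>: "finite \<U>" "E \<subseteq> \<Union>\<U>" "\<forall>U\<in>\<U>. bounded U \<and> diameter U \<le> \<delta>"
        using tb[OF \<open>0 < \<delta>\<close>] by (elim exE conjE)
      obtain \<V> where \<V>: "finite \<V>" "E \<subseteq> \<Union>\<V>" "\<And>U. U \<in> \<V> \<Longrightarrow> bounded U \<and> diameter U \<le> \<delta>"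
        "card \<V> = N"
        using covering_number_attained[OF \<U>(1,2) bspec[OF \<U>(3)]] unfolding N_def by blast
      have "real N \<le> \<delta> powr (- t)"
      proof (cases "N = 0")
        case False
        have "0 < - ln \<delta>" using elim by simp
        moreover have "ln (real N) / (- ln \<delta>) < t"
          using elim(1) unfolding N_def by (simp only: less_ereal.simps)
        ultimately have "ln (real N) < t * (- ln \<delta>)" by (simp only: pos_divide_less_eq)
        then have "ln (real N) \<le> ln (\<delta> powr (- t))" using elim by (simp add: ln_powr)
        then show ?thesis using False \<open>0 < \<delta>\<close> by (subst (asm) ln_le_cancel_iff) auto
      qed simp
      then have "real N * \<delta> powr (s + e) \<le> \<delta> powr (- t) * \<delta> powr (s + e)"
        by (rule mult_right_mono) simp
      also have "\<dots> = \<delta> powr (e / 2)" by (simp add: powr_add[symmetric] t_def field_simps)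
      finally have *: "real N * \<delta> powr (s + e) \<le> \<delta> powr (e / 2)" .
      have "hausdorff_delta (s + e) \<delta> E \<le> ennreal (real (card \<V>) * \<delta> powr (s + e))"
        by (rule hausdorff_delta_le_card) (use \<V> s0 e elim in auto)
      also have "\<dots> \<le> ennreal (\<delta> powr (e / 2))" using * \<V>(4) by (simp add: ennreal_leI)
      finally show ?case .
    qed
    \<comment> \<open>The bound holds only for small radii, but the premeasure grows as the radius shrinks, so
      letting the radius tend to 0 bounds it at every fixed \<open>\<delta>\<close>.\<close>
    have "hausdorff_delta (s + e) \<delta> E \<le> 0" if "0 < \<delta>" for \<delta>
    proof (rule tendsto_lowerbound)
      have "((\<lambda>r. r powr (e / 2)) \<longlongrightarrow> 0 powr (e / 2)) (at_right (0::real))"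
        using e by (intro tendsto_powr' tendsto_intros) (auto simp: eventually_at_right_less eventually_at_filter)
      then have "((\<lambda>r. ennreal (r powr (e / 2))) \<longlongrightarrow> ennreal 0) (at_right 0)"
        using e by (intro tendsto_ennrealI) simp
      then show "((\<lambda>r. ennreal (r powr (e / 2))) \<longlongrightarrow> 0) (at_right 0)" by simp
      have "eventually (\<lambda>r. r \<in> {0<..<\<delta>}) (at_right 0)"
        by (rule eventually_at_right_real) (use that in simp)
      then show "eventually (\<lambda>r. hausdorff_delta (s + e) \<delta> E \<le> ennreal (r powr (e / 2))) (at_right 0)"
        using small
        by eventually_elim (rule order_trans[OF hausdorff_delta_antimono], auto)
    qed simp
    then have "hausdorff_measure (s + e) E \<le> 0"
      unfolding hausdorff_measure_def by (intro SUP_least) auto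
    then have "hausdorff_dim E \<le> ereal (s + e)"
      unfolding hausdorff_dim_def by (intro Inf_lower) (use s0 e in auto)
    then show "hausdorff_dim E \<le> ereal s + ereal e" by simp
  qed
qed

lemma upper_box_dim_le:
  assumes t: "0 \<le> t" and K: "0 < K"
    and N: "eventually (\<lambda>\<delta>. real (covering_number \<delta> E) \<le> K * \<delta> powr (- t)) (at_right 0)"
  shows "upper_box_dim E \<le> ereal t"
proof -
  have ev1: "eventually (\<lambda>\<delta>. \<delta> \<in> {0<..<1::real}) (at_right 0)"
    by (rule eventually_at_right_real) simp
  \<comment> \<open>Taking \<open>max 0 (ln K)\<close> instead of \<open>ln K\<close> also covers a vanishing covering number, where
    \<open>ln 0 = 0\<close>.\<close>
  have "eventually (\<lambda>\<delta>. ereal (ln (real (covering_number \<delta> E)) / (- ln \<delta>))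
      \<le> ereal (max 0 (ln K) / (- ln \<delta>) + t)) (at_right 0)"
    using N ev1
  proof eventually_elim
    case (elim \<delta>)
    define n where "n = covering_number \<delta> E"
    have "ln (real n) \<le> max 0 (ln K) + t * (- ln \<delta>)"
    proof (cases "n = 0")
      case True
      have "t * ln \<delta> \<le> 0" by (rule mult_nonneg_nonpos) (use t elim in auto)
      then show ?thesis using True by simp
    next
      case False
      then have "ln (real n) \<le> ln (K * \<delta> powr (- t))"
        using elim K by (subst ln_le_cancel_iff) (auto simp: n_def)
      also have "\<dots> = ln K + t * (- ln \<delta>)" using elim K by (simp add: ln_mult ln_powr)
      finally show ?thesis by linarith
    qed
    then have "ln (real n) / (- ln \<delta>) \<le> (max 0 (ln K) + t * (- ln \<delta>)) / (- ln \<delta>)"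
      using elim by (intro divide_right_mono) auto
    also have "\<dots> = max 0 (ln K) / (- ln \<delta>) + t" using elim by (simp add: field_simps)
    finally show ?case by (simp add: n_def)
  qed
  then have "upper_box_dim E \<le> Limsup (at_right 0) (\<lambda>\<delta>. ereal (max 0 (ln K) / (- ln \<delta>) + t))"
    unfolding upper_box_dim_def by (rule Limsup_mono)
  also have "\<dots> = ereal t"
  proof (rule lim_imp_Limsup)
    have "filterlim (\<lambda>\<delta>. - ln \<delta> :: real) at_top (at_right 0)"
      using ln_at_0 by (simp add: filterlim_uminus_at_top)
    then have "((\<lambda>\<delta>::real. max 0 (ln K) / (- ln \<delta>) + t) \<longlongrightarrow> 0 + t) (at_right 0)"
      by (intro tendsto_add tendsto_divide_0[OF tendsto_const] filterlim_at_top_imp_at_infinity tendsto_const)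
    then show "((\<lambda>\<delta>. ereal (max 0 (ln K) / (- ln \<delta>) + t)) \<longlongrightarrow> ereal t) (at_right 0)" by simp
  qed simp
  finally show ?thesis .
qed

section \<open>The fractional integral as a convolution\<close>

lemma
  fixes h :: "'a::euclidean_space \<Rightarrow> real"
  assumes "integrable lborel h"
  shows integrable_reflect: "integrable lborel (\<lambda>s. h (p - s))"
    and integral_reflect: "(\<integral>s. h (p - s) \<partial>lborel) = (\<integral>u. h u \<partial>lborel)"
proof -
  have D: "distr lborel borel (\<lambda>s. p - s) = lborel"
    using lborel_affine[of "-1" p] by (simp add: density_1)
  have [measurable]: "h \<in> borel_measurable borel" using assms by auto
  have "integrable (distr lborel borel (\<lambda>s. p - s)) h" using assms by (simp add: D)
  then show "integrable lborel (\<lambda>s. h (p - s))"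
    by (subst (asm) integrable_distr_eq) auto
  have "(\<integral>u. h u \<partial>distr lborel borel (\<lambda>s. p - s)) = (\<integral>s. h (p - s) \<partial>lborel)"
    by (subst integral_distr) auto
  then show "(\<integral>s. h (p - s) \<partial>lborel) = (\<integral>u. h u \<partial>lborel)" by (simp add: D)
qed

lemma
  fixes \<gamma> x :: real
  assumes "0 < \<gamma>" "0 \<le> x"
  shows set_integrable_powr_from_0: "set_integrable lborel {0..x} (\<lambda>s. s powr (\<gamma> - 1))"
    and set_integral_powr_from_0: "(LINT s:{0..x}|lborel. s powr (\<gamma> - 1)) = x powr \<gamma> / \<gamma>"
proof -
  have hi: "((\<lambda>s. s powr (\<gamma> - 1)) has_integral (x powr \<gamma> / \<gamma>)) {0..x}"
    using has_integral_powr_from_0[of "\<gamma> - 1" x] assms by simp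
  then have "(\<lambda>s. s powr (\<gamma> - 1)) absolutely_integrable_on {0..x}"
    by (intro nonnegative_absolutely_integrable_1) auto
  then show *: "set_integrable lborel {0..x} (\<lambda>s. s powr (\<gamma> - 1))"
    unfolding set_integrable_def by (subst (asm) integrable_completion) auto
  show "(LINT s:{0..x}|lborel. s powr (\<gamma> - 1)) = x powr \<gamma> / \<gamma>"
    using set_borel_integral_eq_integral(2)[OF *] hi by (simp add: integral_unique)
qed

lemma
  fixes \<phi> \<psi> :: "real \<Rightarrow> real"
  assumes \<phi>: "integrable lborel \<phi>" and \<psi>: "integrable lborel \<psi>"
  shows integrable_lborel_tensor: "integrable lborel (\<lambda>(s, t). \<phi> s * \<psi> t)"
    and integral_lborel_tensor:
      "(\<integral>(s, t). \<phi> s * \<psi> t \<partial>lborel) = (\<integral>s. \<phi> s \<partial>lborel) * (\<integral>t. \<psi> t \<partial>lborel)"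
proof -
  have [measurable]: "\<phi> \<in> borel_measurable borel" "\<psi> \<in> borel_measurable borel"
    using assms by auto
  have *: "integrable (lborel \<Otimes>\<^sub>M lborel) (\<lambda>(s, t). \<phi> s * \<psi> t)"
    by (rule lborel_pair.Fubini_integrable) (use assms in \<open>auto simp: abs_mult\<close>)
  then show "integrable lborel (\<lambda>(s, t). \<phi> s * \<psi> t)" by (simp add: lborel_prod)
  have "(\<integral>s. \<integral>t. \<phi> s * \<psi> t \<partial>lborel \<partial>lborel) = (\<integral>z. (case z of (s, t) \<Rightarrow> \<phi> s * \<psi> t) \<partial>(lborel \<Otimes>\<^sub>M lborel))"
    using lborel_pair.integral_fst'[OF *] by simp
  then show "(\<integral>(s, t). \<phi> s * \<psi> t \<partial>lborel) = (\<integral>s. \<phi> s \<partial>lborel) * (\<integral>t. \<psi> t \<partial>lborel)"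
    by (simp add: lborel_prod)
qed

definition rl_kernel :: "real \<Rightarrow> real \<Rightarrow> real \<times> real \<Rightarrow> real" where
  "rl_kernel \<gamma>1 \<gamma>2 = (\<lambda>(s, t). s powr (\<gamma>1 - 1) * t powr (\<gamma>2 - 1))"

text \<open>
  The mass of the kernel on the box from 0 to \<open>(x, y)\<close>, that is, the fractional integral of the
  constant 1 up to the factor \<open>1 / (Gamma \<gamma>1 * Gamma \<gamma>2)\<close>.
\<close>

definition rl_mass :: "real \<Rightarrow> real \<Rightarrow> real \<times> real \<Rightarrow> real" where
  "rl_mass \<gamma>1 \<gamma>2 = (\<lambda>(x, y). x powr \<gamma>1 / \<gamma>1 * (y powr \<gamma>2 / \<gamma>2))"

lemma
  fixes x y :: real
  assumes "0 < \<gamma>1" "0 < \<gamma>2" "0 \<le> x" "0 \<le> y"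
  shows set_integrable_rl_kernel: "set_integrable lborel ({0..x} \<times> {0..y}) (rl_kernel \<gamma>1 \<gamma>2)"
    and set_integral_rl_kernel:
      "(LINT s:{0..x} \<times> {0..y}|lborel. rl_kernel \<gamma>1 \<gamma>2 s) = rl_mass \<gamma>1 \<gamma>2 (x, y)"
proof -
  let ?\<phi> = "\<lambda>s. indicator {0..x} s * s powr (\<gamma>1 - 1)" and ?\<psi> = "\<lambda>t. indicator {0..y} t * t powr (\<gamma>2 - 1)"
  have eq: "(\<lambda>p. indicator ({0..x} \<times> {0..y}) p *\<^sub>R rl_kernel \<gamma>1 \<gamma>2 p) = (\<lambda>(s, t). ?\<phi> s * ?\<psi> t)"
    by (auto simp: rl_kernel_def fun_eq_iff indicator_def)
  have i: "integrable lborel ?\<phi>" "integrable lborel ?\<psi>"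
    using set_integrable_powr_from_0 assms unfolding set_integrable_def by auto
  show "set_integrable lborel ({0..x} \<times> {0..y}) (rl_kernel \<gamma>1 \<gamma>2)"
    unfolding set_integrable_def eq by (rule integrable_lborel_tensor[OF i])
  have "(\<integral>s. ?\<phi> s \<partial>lborel) = x powr \<gamma>1 / \<gamma>1" "(\<integral>s. ?\<psi> s \<partial>lborel) = y powr \<gamma>2 / \<gamma>2"
    using set_integral_powr_from_0 assms unfolding set_lebesgue_integral_def by auto
  then show "(LINT s:{0..x} \<times> {0..y}|lborel. rl_kernel \<gamma>1 \<gamma>2 s) = rl_mass \<gamma>1 \<gamma>2 (x, y)"
    unfolding set_lebesgue_integral_def eq integral_lborel_tensor[OF i] by (simp add: rl_mass_def)
qed

text \<open>
  The reflection \<open>u \<mapsto> (x, y) - u\<close> maps the box of integration to itself. It moves the dependence on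
  \<open>(x, y)\<close> from the singular kernel to \<open>f\<close>, where regularity is available.
\<close>

lemma rl_convolution:
  fixes x y :: real
  assumes "set_integrable lborel ({0..x} \<times> {0..y}) (rl_integrand \<gamma>1 \<gamma>2 f (x, y))"
  shows set_integrable_rl_convolution:
      "set_integrable lborel ({0..x} \<times> {0..y}) (\<lambda>s. rl_kernel \<gamma>1 \<gamma>2 s * f ((x, y) - s))"
    and set_integral_rl_convolution:
      "(LINT u:{0..x} \<times> {0..y}|lborel. rl_integrand \<gamma>1 \<gamma>2 f (x, y) u)
       = (LINT s:{0..x} \<times> {0..y}|lborel. rl_kernel \<gamma>1 \<gamma>2 s * f ((x, y) - s))"
proof -
  let ?h = "\<lambda>u. indicator ({0..x} \<times> {0..y}) u *\<^sub>R rl_integrand \<gamma>1 \<gamma>2 f (x, y) u"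
  have eq: "?h ((x, y) - s) = indicator ({0..x} \<times> {0..y}) s *\<^sub>R (rl_kernel \<gamma>1 \<gamma>2 s * f ((x, y) - s))" for s
    by (cases s) (auto simp: rl_kernel_def rl_integrand_def indicator_def)
  note h = assms[unfolded set_integrable_def]
  show "set_integrable lborel ({0..x} \<times> {0..y}) (\<lambda>s. rl_kernel \<gamma>1 \<gamma>2 s * f ((x, y) - s))"
    using integrable_reflect[OF h, of "(x, y)"] unfolding set_integrable_def eq .
  show "(LINT u:{0..x} \<times> {0..y}|lborel. rl_integrand \<gamma>1 \<gamma>2 f (x, y) u)
       = (LINT s:{0..x} \<times> {0..y}|lborel. rl_kernel \<gamma>1 \<gamma>2 s * f ((x, y) - s))"
    using integral_reflect[OF h, of "(x, y)"] unfolding set_lebesgue_integral_def eq by simp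
qed

text \<open>
  Both integrals carry the same kernel after reflection. On the small box the integrands differ by the
  kernel times an increment of \<open>f\<close> by the fixed vector \<open>(x' - x, y' - y)\<close>; on the rest of the large box
  only the integrand for \<open>(x', y')\<close> is present. The kernel masses of these two regions give the two
  terms of the bound. The second one is an increment of a function that is monotone in each variable.
\<close>

lemma rl_increment:
  fixes x y x' y' :: real
  assumes g: "0 < \<gamma>1" "0 < \<gamma>2" and xy: "0 \<le> x" "x \<le> x'" "0 \<le> y" "y \<le> y'"
    and int: "set_integrable lborel ({0..x} \<times> {0..y}) (rl_integrand \<gamma>1 \<gamma>2 f (x, y))"
      "set_integrable lborel ({0..x'} \<times> {0..y'}) (rl_integrand \<gamma>1 \<gamma>2 f (x', y'))"
    and H: "\<And>u v. u \<in> {0..x} \<Longrightarrow> v \<in> {0..y} \<Longrightarrow> \<bar>f ((u, v) + ((x', y') - (x, y))) - f (u, v)\<bar> \<le> H"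
    and M: "\<And>u v. u \<in> {0..x'} \<Longrightarrow> v \<in> {0..y'} \<Longrightarrow> \<bar>f (u, v)\<bar> \<le> M"
  shows "\<bar>(LINT u:{0..x'} \<times> {0..y'}|lborel. rl_integrand \<gamma>1 \<gamma>2 f (x', y') u)
     - (LINT u:{0..x} \<times> {0..y}|lborel. rl_integrand \<gamma>1 \<gamma>2 f (x, y) u)\<bar>
     \<le> H * rl_mass \<gamma>1 \<gamma>2 (x, y) + M * (rl_mass \<gamma>1 \<gamma>2 (x', y') - rl_mass \<gamma>1 \<gamma>2 (x, y))"
proof -
  define Q Q' where "Q = {0..x} \<times> {0..y}" and "Q' = {0..x'} \<times> {0..y'}"
  define k where "k = rl_kernel \<gamma>1 \<gamma>2"
  have [measurable]: "Q \<in> sets lborel" "Q' \<in> sets lborel"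
    unfolding Q_def Q'_def by (auto intro: borel_closed closed_Times)
  have sub: "Q \<subseteq> Q'" using xy by (auto simp: Q_def Q'_def)
  have k0: "0 \<le> k s" for s by (auto simp: k_def rl_kernel_def split: prod.split)
  define F F' where "F s = k s * f ((x, y) - s)" and "F' s = k s * f ((x', y') - s)" for s
  have iF: "set_integrable lborel Q F" and iF': "set_integrable lborel Q' F'"
    using int[THEN set_integrable_rl_convolution] by (auto simp: F_def[abs_def] F'_def[abs_def] k_def Q_def Q'_def)
  have ik: "set_integrable lborel Q k" "set_integrable lborel Q' k"
    unfolding Q_def Q'_def k_def using set_integrable_rl_kernel g xy by auto
  let ?\<Delta> = "\<lambda>s. indicator Q' s *\<^sub>R F' s - indicator Q s *\<^sub>R F s"
  let ?B = "\<lambda>s. H * (indicator Q s *\<^sub>R k s) + M * (indicator Q' s *\<^sub>R k s - indicator Q s *\<^sub>R k s)"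
  have le: "norm (?\<Delta> s) \<le> ?B s" for s
  proof -
    obtain u v where s: "s = (u, v)" by fastforce
    consider "s \<in> Q" | "s \<in> Q'" "s \<notin> Q" | "s \<notin> Q'" using sub by blast
    then show ?thesis
    proof cases
      case 1
      have "\<bar>f ((x - u, y - v) + ((x', y') - (x, y))) - f (x - u, y - v)\<bar> \<le> H"
        by (rule H) (use 1 in \<open>auto simp: Q_def s\<close>)
      then have "\<bar>f ((x', y') - s) - f ((x, y) - s)\<bar> \<le> H" by (simp add: s algebra_simps)
      then have "k s * \<bar>f ((x', y') - s) - f ((x, y) - s)\<bar> \<le> k s * H"
        by (rule mult_left_mono) (rule k0)
      moreover have "F' s - F s = k s * (f ((x', y') - s) - f ((x, y) - s))"
        by (simp add: F_def F'_def algebra_simps)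
      ultimately show ?thesis using 1 sub k0[of s] by (auto simp: abs_mult mult.commute)
    next
      case 2
      have "\<bar>f ((x', y') - s)\<bar> \<le> M"
        using M[of "x' - u" "y' - v"] 2 by (auto simp: Q'_def s)
      then have "k s * \<bar>f ((x', y') - s)\<bar> \<le> k s * M"
        by (rule mult_left_mono) (rule k0)
      then show ?thesis using 2 k0[of s] by (auto simp: F'_def abs_mult mult.commute)
    next
      case 3
      then have "s \<notin> Q" using sub by blast
      then show ?thesis using 3 by simp
    qed
  qed
  note I = iF[unfolded set_integrable_def] iF'[unfolded set_integrable_def] ik[unfolded set_integrable_def]
  have i\<Delta>: "integrable lborel ?\<Delta>" by (intro Bochner_Integration.integrable_diff I)
  have iB: "integrable lborel ?B"
    by (intro Bochner_Integration.integrable_add Bochner_Integration.integrable_diff integrable_mult_right I)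
  have "\<bar>(\<integral>s. ?\<Delta> s \<partial>lborel)\<bar> \<le> (\<integral>s. ?B s \<partial>lborel)"
    unfolding real_norm_def[symmetric]
    by (rule Bochner_Integration.integral_norm_bound_integral[OF i\<Delta> iB le])
  also have "(\<integral>s. ?B s \<partial>lborel) = H * (LINT s:Q|lborel. k s) + M * ((LINT s:Q'|lborel. k s) - (LINT s:Q|lborel. k s))"
    unfolding set_lebesgue_integral_def
    by (simp only: Bochner_Integration.integral_add Bochner_Integration.integral_diff integral_mult_right_zero
        Bochner_Integration.integrable_diff integrable_mult_right I)
  also have "(\<integral>s. ?\<Delta> s \<partial>lborel) = (LINT s:Q'|lborel. F' s) - (LINT s:Q|lborel. F s)"
    unfolding set_lebesgue_integral_def by (rule Bochner_Integration.integral_diff[OF I(2,1)])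
  finally show ?thesis
    using xy int[THEN set_integral_rl_convolution] set_integral_rl_kernel[OF g]
    by (simp add: F_def[abs_def] F'_def[abs_def] k_def Q_def Q'_def)
qed

lemma rl_mass_mono:
  assumes "0 < \<gamma>1" "0 < \<gamma>2" "0 \<le> x" "x \<le> x'" "0 \<le> y" "y \<le> y'"
  shows "rl_mass \<gamma>1 \<gamma>2 (x, y) \<le> rl_mass \<gamma>1 \<gamma>2 (x', y')"
  unfolding rl_mass_def using assms
  by (auto intro!: mult_mono divide_right_mono powr_mono2)

section \<open>Box counting for graphs that are Hoelder up to a monotone function\<close>

lemma diameter_box_le:
  fixes x y z :: real
  assumes "0 \<le> u" "0 \<le> v" "0 \<le> w"
  shows "bounded ({x..x + u} \<times> {y..y + v} \<times> {z..z + w})"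
    and "diameter ({x..x + u} \<times> {y..y + v} \<times> {z..z + w}) \<le> u + v + w"
proof -
  show "bounded ({x..x + u} \<times> {y..y + v} \<times> {z..z + w})"
    by (intro bounded_Times) auto
  show "diameter ({x..x + u} \<times> {y..y + v} \<times> {z..z + w}) \<le> u + v + w"
  proof (rule diameter_le)
    fix p q assume "p \<in> {x..x + u} \<times> {y..y + v} \<times> {z..z + w}" "q \<in> {x..x + u} \<times> {y..y + v} \<times> {z..z + w}"
    then obtain p1 p2 p3 q1 q2 q3 where pq: "p = (p1, p2, p3)" "q = (q1, q2, q3)"
      "\<bar>p1 - q1\<bar> \<le> u" "\<bar>p2 - q2\<bar> \<le> v" "\<bar>p3 - q3\<bar> \<le> w"
      by (auto simp: abs_le_iff)
    have "norm (p - q) \<le> norm (p1 - q1) + norm (p2 - q2, p3 - q3)"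
      unfolding pq using norm_Pair_le[of "p1 - q1" "(p2 - q2, p3 - q3)"] by simp
    also have "norm (p2 - q2, p3 - q3) \<le> norm (p2 - q2) + norm (p3 - q3)" by (rule norm_Pair_le)
    finally show "norm (p - q) \<le> u + v + w" using pq by simp
  qed (use assms in simp)
qed

lemma exists_grid_interval:
  fixes x :: real
  assumes "0 < b" "0 \<le> x" "x \<le> b" "0 < n"
  shows "\<exists>i<n. b * real i / real n \<le> x \<and> x \<le> b * real (Suc i) / real n"
proof (cases "x = b")
  case True
  then show ?thesis using assms
    by (intro exI[of _ "n - 1"]) (auto simp: field_simps mult_left_mono)
next
  case False
  define i where "i = nat \<lfloor>x * n / b\<rfloor>"
  have i: "real i \<le> x * n / b" "x * n / b < real i + 1"
    using assms by (simp_all add: i_def)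
  have "x * n / b < n" using False assms by (simp add: field_simps)
  then have "i < n" using i by linarith
  then show ?thesis using i assms by (intro exI[of _ i]) (auto simp: field_simps)
qed

text \<open>
  A function that is monotone in each variable has small total oscillation over an \<open>n \<times> n\<close> grid. Each
  diagonal increment is a horizontal plus a vertical one, and these telescope along the rows and the
  columns. There are \<open>2 * n\<close> lines, each contributing at most the total increase of \<open>P\<close>; so the sum over
  \<open>n\<^sup>2\<close> cells is only linear in \<open>n\<close>.
\<close>

lemma sum_diagonal_increments_le:
  fixes P :: "nat \<Rightarrow> nat \<Rightarrow> real"
  assumes mono: "\<And>i j i' j'. i \<le> i' \<Longrightarrow> i' \<le> n \<Longrightarrow> j \<le> j' \<Longrightarrow> j' \<le> n \<Longrightarrow> P i j \<le> P i' j'"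
  shows "(\<Sum>i<n. \<Sum>j<n. P (Suc i) (Suc j) - P i j) \<le> 2 * real n * (P n n - P 0 0)"
proof -
  have "(\<Sum>i<n. \<Sum>j<n. P (Suc i) (Suc j) - P i j)
      = (\<Sum>i<n. \<Sum>j<n. (P (Suc i) (Suc j) - P i (Suc j)) + (P i (Suc j) - P i j))"
    by simp
  also have "\<dots> = (\<Sum>j<n. \<Sum>i<n. P (Suc i) (Suc j) - P i (Suc j)) + (\<Sum>i<n. \<Sum>j<n. P i (Suc j) - P i j)"
    unfolding sum.distrib by (subst sum.swap) simp
  also have "\<dots> = (\<Sum>j<n. P n (Suc j) - P 0 (Suc j)) + (\<Sum>i<n. P i n - P i 0)"
  proof -
    have "(\<Sum>i<n. P (Suc i) (Suc j) - P i (Suc j)) = P n (Suc j) - P 0 (Suc j)" for j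
      by (rule sum_lessThan_telescope[where f = "\<lambda>i. P i (Suc j)"])
    moreover have "(\<Sum>j<n. P i (Suc j) - P i j) = P i n - P i 0" for i
      by (rule sum_lessThan_telescope)
    ultimately show ?thesis by simp
  qed
  also have "\<dots> \<le> (\<Sum>j<n. P n n - P 0 0) + (\<Sum>i<n. P n n - P 0 0)"
    by (intro add_mono sum_mono diff_mono mono) auto
  finally show ?thesis by simp
qed

text \<open>
  Over the cell with lower corner \<open>(x i, y j)\<close> the function \<open>g\<close> stays within \<open>r i j\<close> of its value at that
  corner, so at most \<open>2 * r i j * n + 1\<close> boxes of height \<open>1 / n\<close> cover the graph there. Comparing with
  the lower corner only is what allows the increment condition to be one-sided. Summed over the cells,
  the Hoelder part of \<open>r\<close> contributes \<open>O(n powr (3 - \<mu>))\<close>, the monotone part \<open>O(n\<^sup>2)\<close> by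
  \<open>sum_diagonal_increments_le\<close>, and the boxes that are not filled \<open>n\<^sup>2\<close>.
\<close>

lemma graph_grid_cover:
  fixes b d A \<mu> :: real and g \<Phi> :: "real \<times> real \<Rightarrow> real" and n :: nat
  assumes bd: "0 < b" "0 < d" and A: "0 \<le> A" and \<mu>: "0 < \<mu>" "\<mu> < 1" and n: "0 < n"
    and mono: "\<And>x y x' y'. \<lbrakk>0 \<le> x; x \<le> x'; x' \<le> b; 0 \<le> y; y \<le> y'; y' \<le> d\<rbrakk> \<Longrightarrow> \<Phi> (x, y) \<le> \<Phi> (x', y')"
    and osc: "\<And>x y x' y'. \<lbrakk>0 \<le> x; x \<le> x'; x' \<le> b; 0 \<le> y; y \<le> y'; y' \<le> d\<rbrakk> \<Longrightarrow>
      \<bar>g (x', y') - g (x, y)\<bar> \<le> A * norm (x' - x, y' - y) powr \<mu> + (\<Phi> (x', y') - \<Phi> (x, y))"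
  obtains \<U> where "finite \<U>" "graph_over ({0..b} \<times> {0..d}) g \<subseteq> \<Union>\<U>"
    "\<And>U. U \<in> \<U> \<Longrightarrow> bounded U \<and> diameter U \<le> (b + d + 1) / real n"
    "real (card \<U>) \<le> (2 * A * (b + d) powr \<mu> + 4 * (\<Phi> (b, d) - \<Phi> (0, 0)) + 1) * real n powr (3 - \<mu>)"
proof -
  define x where "x i = b * real i / real n" for i :: nat
  define y where "y i = d * real i / real n" for i :: nat
  have x_mono: "x i \<le> x j" "y i \<le> y j" if "i \<le> j" for i j
    using that bd n unfolding x_def y_def by (auto intro!: divide_right_mono mult_left_mono)
  have xb: "x 0 = 0" "y 0 = 0" "x n = b" "y n = d" using n by (auto simp: x_def y_def)
  have xS: "x (Suc i) = x i + b / n" "y (Suc i) = y i + d / n" for i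
    by (simp_all add: x_def y_def distrib_left add_divide_distrib)
  define r where "r i j = A * ((b + d) / n) powr \<mu> + (\<Phi> (x (Suc i), y (Suc j)) - \<Phi> (x i, y j))" for i j
  define m where "m i j = nat \<lfloor>2 * r i j * n\<rfloor>" for i j
  \<comment> \<open>The values of \<open>g\<close> over a cell lie in an interval of length \<open>2 * r i j\<close>, which starts \<open>r i j\<close>
    below the value at the corner; \<open>m i j + 1\<close> boxes stacked from there reach its upper end.\<close>
  define box where "box i j k = {x i..x i + b / n} \<times> {y j..y j + d / n} \<times>
      {g (x i, y j) - r i j + real k / n..g (x i, y j) - r i j + real k / n + 1 / n}" for i j k :: nat
  define \<U> where "\<U> = (\<Union>i\<in>{..<n}. \<Union>j\<in>{..<n}. box i j ` {..m i j})"
  have Pm: "\<Phi> (x i, y j) \<le> \<Phi> (x i', y j')" if "i \<le> i'" "i' \<le> n" "j \<le> j'" "j' \<le> n" for i j i' j'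
    by (rule mono) (use that x_mono[of 0 i] x_mono[of 0 j] x_mono[of i i'] x_mono[of j j']
        x_mono[of i' n] x_mono[of j' n] xb in auto)
  have r0: "0 \<le> r i j" if "i < n" "j < n" for i j
    using Pm[of i "Suc i" j "Suc j"] that A by (simp add: r_def)
  have "finite \<U>" unfolding \<U>_def by auto
  moreover have "graph_over ({0..b} \<times> {0..d}) g \<subseteq> \<Union>\<U>"
  proof
    fix p assume "p \<in> graph_over ({0..b} \<times> {0..d}) g"
    then obtain s t where p: "p = (s, t, g (s, t))" and st: "0 \<le> s" "s \<le> b" "0 \<le> t" "t \<le> d"
      by (auto simp: graph_over_def)
    obtain i where i: "i < n" "x i \<le> s" "s \<le> x (Suc i)"
      using exists_grid_interval[OF bd(1) st(1,2) n] by (auto simp: x_def)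
    obtain j where j: "j < n" "y j \<le> t" "t \<le> y (Suc j)"
      using exists_grid_interval[OF bd(2) st(3,4) n] by (auto simp: y_def)
    have ij0: "0 \<le> x i" "0 \<le> y j" "x (Suc i) \<le> b" "y (Suc j) \<le> d"
      using x_mono[of 0 i] x_mono[of 0 j] x_mono[of "Suc i" n] x_mono[of "Suc j" n] xb i j by auto
    have "norm (s - x i, t - y j) \<le> norm (s - x i) + norm (t - y j)" by (rule norm_Pair_le)
    also have "\<dots> \<le> (b + d) / n" using i j by (simp add: xS add_divide_distrib)
    finally have nm: "norm (s - x i, t - y j) powr \<mu> \<le> ((b + d) / n) powr \<mu>"
      using \<mu> by (intro powr_mono2) auto
    have "\<bar>g (s, t) - g (x i, y j)\<bar> \<le> A * norm (s - x i, t - y j) powr \<mu> + (\<Phi> (s, t) - \<Phi> (x i, y j))"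
      by (rule osc) (use i j st ij0 in auto)
    also have "\<dots> \<le> r i j"
      unfolding r_def using A nm mono[of s "x (Suc i)" t "y (Suc j)"] i j st ij0
      by (intro add_mono mult_left_mono diff_mono) auto
    finally have gr: "\<bar>g (s, t) - g (x i, y j)\<bar> \<le> r i j" .
    define h where "h = g (s, t) - (g (x i, y j) - r i j)"
    have h: "0 \<le> h" "h \<le> 2 * r i j" using gr by (auto simp: h_def abs_le_iff)
    define k where "k = nat \<lfloor>h * n\<rfloor>"
    have "h * n \<le> 2 * r i j * n" using h by (intro mult_right_mono) auto
    then have "k \<le> m i j" by (auto simp: k_def m_def intro!: nat_mono floor_mono)
    moreover have "real k \<le> h * n" "h * n \<le> real k + 1" using h by (auto simp: k_def)
    then have "real k / n \<le> h" "h \<le> real k / n + 1 / n"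
      using n by (simp_all add: field_simps)
    then have "p \<in> box i j k"
      using i j by (auto simp: box_def p xS h_def)
    ultimately show "p \<in> \<Union>\<U>" using i j unfolding \<U>_def by blast
  qed
  moreover have "bounded U \<and> diameter U \<le> (b + d + 1) / real n" if "U \<in> \<U>" for U
    using that diameter_box_le[of "b / n" "d / n" "1 / n"] bd
    by (auto simp: \<U>_def box_def add_divide_distrib)
  moreover have "real (card \<U>) \<le> (2 * A * (b + d) powr \<mu> + 4 * (\<Phi> (b, d) - \<Phi> (0, 0)) + 1) * real n powr (3 - \<mu>)"
  proof -
    have poly: "N * (N * (2 * N * A' * X + 1)) + 2 * N * (2 * N * D)
        = 2 * A' * (X * N ^ 3) + (4 * D + 1) * N ^ 2" for N A' X D :: real
      by (simp add: power2_eq_square power3_eq_cube algebra_simps)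
    have "card \<U> \<le> (\<Sum>i<n. card (\<Union>j\<in>{..<n}. box i j ` {..m i j}))"
      unfolding \<U>_def by (rule card_UN_le) simp
    also have "\<dots> \<le> (\<Sum>i<n. \<Sum>j<n. card (box i j ` {..m i j}))"
      by (intro sum_mono card_UN_le) simp
    also have "\<dots> \<le> (\<Sum>i<n. \<Sum>j<n. m i j + 1)"
      by (intro sum_mono) (rule order_trans[OF card_image_le], auto)
    finally have "real (card \<U>) \<le> real (\<Sum>i<n. \<Sum>j<n. m i j + 1)" by (simp only: of_nat_le_iff)
    also have "\<dots> = (\<Sum>i<n. \<Sum>j<n. real (m i j) + 1)" by (simp only: of_nat_sum of_nat_add of_nat_1)
    also have "\<dots> \<le> (\<Sum>i<n. \<Sum>j<n. 2 * r i j * n + 1)"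
      by (intro sum_mono add_right_mono) (auto simp: m_def r0)
    also have "\<dots> = (\<Sum>i<n. \<Sum>j<n. (2 * real n * A * ((b + d) / n) powr \<mu> + 1)
        + 2 * real n * (\<Phi> (x (Suc i), y (Suc j)) - \<Phi> (x i, y j)))"
      by (intro sum.cong refl) (simp add: r_def algebra_simps)
    also have "\<dots> = real n * (real n * (2 * real n * A * ((b + d) / n) powr \<mu> + 1))
        + 2 * real n * (\<Sum>i<n. \<Sum>j<n. \<Phi> (x (Suc i), y (Suc j)) - \<Phi> (x i, y j))"
      by (simp only: sum.distrib sum_distrib_left sum_constant card_lessThan distrib_left)
    also have "\<dots> \<le> real n * (real n * (2 * real n * A * ((b + d) / n) powr \<mu> + 1))
        + 2 * real n * (2 * real n * (\<Phi> (x n, y n) - \<Phi> (x 0, y 0)))"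
      by (rule add_left_mono, rule mult_left_mono,
          rule sum_diagonal_increments_le[where P = "\<lambda>i j. \<Phi> (x i, y j)"], rule Pm) simp_all
    also have "\<dots> = 2 * A * (((b + d) / n) powr \<mu> * real n ^ 3)
        + (4 * (\<Phi> (b, d) - \<Phi> (0, 0)) + 1) * real n ^ 2"
      unfolding xb by (rule poly)
    also have "((b + d) / n) powr \<mu> * real n ^ 3 = (b + d) powr \<mu> * real n powr (3 - \<mu>)"
      using bd n by (simp add: powr_divide powr_diff)
    also have "(4 * (\<Phi> (b, d) - \<Phi> (0, 0)) + 1) * real n ^ 2 \<le> (4 * (\<Phi> (b, d) - \<Phi> (0, 0)) + 1) * real n powr (3 - \<mu>)"
    proof (rule mult_left_mono)
      have "real n ^ 2 = real n powr 2" using n by simp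
      also have "\<dots> \<le> real n powr (3 - \<mu>)" using n \<mu> by (intro powr_mono) auto
      finally show "real n ^ 2 \<le> real n powr (3 - \<mu>)" .
      show "0 \<le> 4 * (\<Phi> (b, d) - \<Phi> (0, 0)) + 1" using mono[of 0 b 0 d] bd by simp
    qed
    finally show ?thesis by (simp add: algebra_simps)
  qed
  ultimately show thesis by (rule that)
qed

text \<open>
  For \<open>\<Phi> = 0\<close> this is the classical bound for the graph of a Hoelder function of two variables. A term
  \<open>\<Phi>\<close> that is monotone in each variable leaves it unchanged, however irregular \<open>\<Phi>\<close> may be.
\<close>

lemma graph_dims_of_holder_up_to_monotone:
  fixes b d A \<mu> :: real and g \<Phi> :: "real \<times> real \<Rightarrow> real"
  assumes bd: "0 < b" "0 < d" and A: "0 \<le> A" and \<mu>: "0 < \<mu>" "\<mu> < 1"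
    and mono: "\<And>x y x' y'. \<lbrakk>0 \<le> x; x \<le> x'; x' \<le> b; 0 \<le> y; y \<le> y'; y' \<le> d\<rbrakk> \<Longrightarrow> \<Phi> (x, y) \<le> \<Phi> (x', y')"
    and osc: "\<And>x y x' y'. \<lbrakk>0 \<le> x; x \<le> x'; x' \<le> b; 0 \<le> y; y \<le> y'; y' \<le> d\<rbrakk> \<Longrightarrow>
      \<bar>g (x', y') - g (x, y)\<bar> \<le> A * norm (x' - x, y' - y) powr \<mu> + (\<Phi> (x', y') - \<Phi> (x, y))"
  shows "hausdorff_dim (graph_over ({0..b} \<times> {0..d}) g) \<le> upper_box_dim (graph_over ({0..b} \<times> {0..d}) g)"
    and "upper_box_dim (graph_over ({0..b} \<times> {0..d}) g) \<le> ereal (3 - \<mu>)"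
proof -
  let ?G = "graph_over ({0..b} \<times> {0..d}) g"
  define D where "D = b + d + 1"
  define K where "K = 2 * A * (b + d) powr \<mu> + 4 * (\<Phi> (b, d) - \<Phi> (0, 0)) + 1"
  have D: "1 < D" using bd by (simp add: D_def)
  have "\<Phi> (0, 0) \<le> \<Phi> (b, d)" using mono[of 0 b 0 d] bd by simp
  moreover have "0 \<le> 2 * A * (b + d) powr \<mu>" using A by simp
  ultimately have K: "0 < K" unfolding K_def by (intro add_nonneg_pos add_nonneg_nonneg) auto
  have cover: "\<exists>\<U>. finite \<U> \<and> ?G \<subseteq> \<Union>\<U> \<and> (\<forall>U\<in>\<U>. bounded U \<and> diameter U \<le> \<delta>)
      \<and> real (card \<U>) \<le> K * real n powr (3 - \<mu>)"
    if "0 < \<delta>" and n: "n = nat \<lceil>D / \<delta>\<rceil>" for \<delta> n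
  proof -
    have "0 < D / \<delta>" using D that by simp
    then have n0: "0 < n" and nD: "D / \<delta> \<le> real n" unfolding n by linarith+
    have le: "D / real n \<le> \<delta>" using nD n0 \<open>0 < \<delta>\<close> by (simp add: field_simps)
    obtain \<U> where \<U>: "finite \<U>" "?G \<subseteq> \<Union>\<U>"
      "\<And>U. U \<in> \<U> \<Longrightarrow> bounded U \<and> diameter U \<le> D / real n" "real (card \<U>) \<le> K * real n powr (3 - \<mu>)"
      using graph_grid_cover[OF bd A \<mu> n0 mono osc] unfolding D_def K_def by blast
    then show ?thesis using le by (intro exI[of _ \<U>]) (blast intro: order_trans)
  qed
  show "hausdorff_dim ?G \<le> upper_box_dim ?G"
  proof (rule hausdorff_dim_le_upper_box_dim)
    fix \<delta> :: real assume "0 < \<delta>"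
    from cover[OF this refl]
    show "\<exists>\<U>. finite \<U> \<and> ?G \<subseteq> \<Union>\<U> \<and> (\<forall>U\<in>\<U>. bounded U \<and> diameter U \<le> \<delta>)"
      by (elim exE conjE) (intro exI conjI)
  qed
  show "upper_box_dim ?G \<le> ereal (3 - \<mu>)"
  proof (rule upper_box_dim_le)
    show "0 < K * (2 * D) powr (3 - \<mu>)" using K D by simp
    have "eventually (\<lambda>\<delta>. \<delta> \<in> {0<..<1::real}) (at_right 0)"
      by (rule eventually_at_right_real) simp
    then show "eventually (\<lambda>\<delta>. real (covering_number \<delta> ?G)
        \<le> K * (2 * D) powr (3 - \<mu>) * \<delta> powr (- (3 - \<mu>))) (at_right 0)"
    proof eventually_elim
      case (elim \<delta>)
      define n where "n = nat \<lceil>D / \<delta>\<rceil>"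
      obtain \<U> where \<U>: "finite \<U>" "?G \<subseteq> \<Union>\<U>" "\<forall>U\<in>\<U>. bounded U \<and> diameter U \<le> \<delta>"
        "real (card \<U>) \<le> K * real n powr (3 - \<mu>)"
        using cover[OF _ n_def] elim by (metis greaterThanLessThan_iff)
      \<comment> \<open>As \<open>\<delta> < 1 < D\<close>, rounding \<open>D / \<delta>\<close> up to an integer at most doubles it.\<close>
      have "1 \<le> D / \<delta>" using D elim by (simp add: field_simps)
      then have "real n \<le> D / \<delta> + 1" unfolding n_def by linarith
      also have "\<dots> \<le> 2 * D / \<delta>" using \<open>1 \<le> D / \<delta>\<close> by simp
      finally have "real n powr (3 - \<mu>) \<le> (2 * D / \<delta>) powr (3 - \<mu>)"
        using \<mu> by (intro powr_mono2) auto
      also have "\<dots> = (2 * D) powr (3 - \<mu>) * \<delta> powr (- (3 - \<mu>))"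
        using D elim by (subst powr_divide) (auto simp: powr_minus_divide simp del: minus_diff_eq)
      finally have "K * real n powr (3 - \<mu>) \<le> K * ((2 * D) powr (3 - \<mu>) * \<delta> powr (- (3 - \<mu>)))"
        using K by (intro mult_left_mono) auto
      moreover have "covering_number \<delta> ?G \<le> card \<U>"
        by (rule covering_number_le_card) (use \<U> in auto)
      ultimately show ?case using \<U>(4) by (simp add: mult.assoc)
    qed
  qed (use \<mu> in simp)
qed

section \<open>Dimensions of the graph of the fractional integral\<close>

theorem theorem4p1:
  fixes a b c d \<mu> \<gamma>1 \<gamma>2 :: real and f :: "real \<times> real \<Rightarrow> real"
  assumes "0 \<le> a" and "a < b" and "0 \<le> c" and "c < d"
    and "(0, 0) \<in> {a..b} \<times> {c..d}"
    and "0 < \<mu>" and "\<mu> < 1"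
    and "f \<in> holder_class \<mu> ({a..b} \<times> {c..d})"
    and "f (0, 0) = 0"
    and "0 < \<gamma>1" and "\<gamma>1 < 1" and "0 < \<gamma>2" and "\<gamma>2 < 1"
    and "mixed_rl_exists a c \<gamma>1 \<gamma>2 ({a..b} \<times> {c..d}) f"
  shows "hausdorff_dim (graph_over ({a..b} \<times> {c..d}) (mixed_rl_integral a c \<gamma>1 \<gamma>2 f))
           \<le> upper_box_dim (graph_over ({a..b} \<times> {c..d}) (mixed_rl_integral a c \<gamma>1 \<gamma>2 f))
       \<and> upper_box_dim (graph_over ({a..b} \<times> {c..d}) (mixed_rl_integral a c \<gamma>1 \<gamma>2 f))
           \<le> ereal (3 - \<mu>)"
proof -
  have a: "a = 0" and c: "c = 0" using assms(1,3,5) by auto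
  have bd: "0 < b" "0 < d" using assms(2,4) a c by auto
  have \<gamma>: "0 < \<gamma>1" "0 < \<gamma>2" and \<mu>: "0 < \<mu>" "\<mu> < 1" by fact+
  obtain C where C: "0 < C" and hol: "\<And>x y k1 k2. (x, y) \<in> {0..b} \<times> {0..d} \<Longrightarrow>
      (x + k1, y + k2) \<in> {0..b} \<times> {0..d} \<Longrightarrow> \<bar>f (x + k1, y + k2) - f (x, y)\<bar> \<le> C * norm (k1, k2) powr \<mu>"
    using assms(8) unfolding holder_class_def a c by blast
  have int: "set_integrable lborel ({0..x} \<times> {0..y}) (rl_integrand \<gamma>1 \<gamma>2 f (x, y))"
    if "x \<in> {0..b}" "y \<in> {0..d}" for x y
    using assms(14) that unfolding mixed_rl_exists_def a c by blast
  \<comment> \<open>A Hoelder function that vanishes at the origin is bounded by its increments from there.\<close>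
  define M where "M = C * (b + d) powr \<mu>"
  have M: "\<bar>f (u, v)\<bar> \<le> M" if "u \<in> {0..b}" "v \<in> {0..d}" for u v
  proof -
    have "\<bar>f (u, v)\<bar> \<le> C * norm (u, v) powr \<mu>" using hol[of 0 0 u v] that assms(9) bd by simp
    also have "norm (u, v) \<le> b + d" using norm_Pair_le[of u v] that by simp
    then have "C * norm (u, v) powr \<mu> \<le> M"
      unfolding M_def using C \<mu> by (intro mult_left_mono powr_mono2) auto
    finally show ?thesis .
  qed
  have M0: "0 \<le> M" using C by (simp add: M_def)
  define L where "L = 1 / (Gamma \<gamma>1 * Gamma \<gamma>2)"
  have L: "0 \<le> L" using \<gamma> by (simp add: L_def less_imp_le Gamma_real_pos)
  define g where "g = mixed_rl_integral a c \<gamma>1 \<gamma>2 f"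
  define \<Phi> where "\<Phi> p = L * M * rl_mass \<gamma>1 \<gamma>2 p" for p
  define A where "A = L * C * rl_mass \<gamma>1 \<gamma>2 (b, d)"
  have mass0: "0 \<le> rl_mass \<gamma>1 \<gamma>2 p" for p using \<gamma> by (auto simp: rl_mass_def split: prod.split)
  have A0: "0 \<le> A" using L C mass0 by (simp add: A_def)
  have mono: "\<Phi> (x, y) \<le> \<Phi> (x', y')"
    if "0 \<le> x" "x \<le> x'" "x' \<le> b" "0 \<le> y" "y \<le> y'" "y' \<le> d" for x y x' y'
    unfolding \<Phi>_def using that \<gamma> L M0 by (intro mult_left_mono rl_mass_mono) auto
  have osc: "\<bar>g (x', y') - g (x, y)\<bar> \<le> A * norm (x' - x, y' - y) powr \<mu> + (\<Phi> (x', y') - \<Phi> (x, y))"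
    if xy: "0 \<le> x" "x \<le> x'" "x' \<le> b" "0 \<le> y" "y \<le> y'" "y' \<le> d" for x y x' y'
  proof -
    let ?I = "\<lambda>x y. LINT u:{0..x} \<times> {0..y}|lborel. rl_integrand \<gamma>1 \<gamma>2 f (x, y) u"
    let ?m = "rl_mass \<gamma>1 \<gamma>2" and ?H = "C * norm (x' - x, y' - y) powr \<mu>"
    have "\<bar>?I x' y' - ?I x y\<bar> \<le> ?H * ?m (x, y) + M * (?m (x', y') - ?m (x, y))"
    proof (rule rl_increment[OF \<gamma>])
      fix u v assume "u \<in> {0..x}" "v \<in> {0..y}"
      then show "\<bar>f ((u, v) + ((x', y') - (x, y))) - f (u, v)\<bar> \<le> ?H"
        using hol[of u v "x' - x" "y' - y"] xy by simp
    qed (use xy int M in auto)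
    also have "\<dots> \<le> ?H * ?m (b, d) + M * (?m (x', y') - ?m (x, y))"
      using xy \<gamma> C by (intro add_right_mono mult_left_mono rl_mass_mono) auto
    finally have "L * \<bar>?I x' y' - ?I x y\<bar> \<le> L * (?H * ?m (b, d) + M * (?m (x', y') - ?m (x, y)))"
      using L by (rule mult_left_mono)
    moreover have "g (x', y') - g (x, y) = L * (?I x' y' - ?I x y)"
      by (simp add: g_def mixed_rl_integral_def a c L_def right_diff_distrib diff_divide_distrib)
    then have "\<bar>g (x', y') - g (x, y)\<bar> = L * \<bar>?I x' y' - ?I x y\<bar>"
      using L by (simp only: abs_mult abs_of_nonneg)
    ultimately show ?thesis by (simp add: A_def \<Phi>_def algebra_simps)
  qed
  show ?thesis
    using graph_dims_of_holder_up_to_monotone[OF bd A0 \<mu> mono osc]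
    unfolding g_def a c by blast
qed

end
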